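(* Let $(A(k))_{k\ge0}$ and $(B(k))_{k\ge0}$ be sequences (not depending on $x$ or $y$) satisfying, as an identity of functions of $x$ near $0$, $$\sum_{k=0}^\infty A(k)\,x^k=\sum_{k=0}^\infty B(k)\frac{1}{(xtq^k;q)_\infty}.$$ Then $$\sum_{k=0}^\infty A(k)\,p_k(x,y,a)=\sum_{k=0}^\infty B(k)\frac{1}{(xtq^k;q)_\infty}\;{}_1\Phi_1\left[\begin{array}{c}a\\ 0\end{array};q;\,ytq^k\right],$$ supposing that all the series in the two displayed identities are convergent.
   Context: $q$ is a fixed complex number with $|q|<1$; $a,t,x,y$ are complex. The $q$-shifted factorials are $(a;q)_0=1$, $(a;q)_n=\prod_{i=0}^{n-1}(1-aq^i)$, $(a;q)_\infty=\prod_{i=0}^\infty(1-aq^i)$. The series ${}_1\Phi_1$ is $${}_1\Phi_1\left[\begin{array}{c}a\\ 0\end{array};q;z\right]=\sum_{n=0}^\infty(-1)^nq^{n(n-1)/2}\frac{(a;q)_n}{(q;q)_n}z^n.$$ With $\binom{n}{k}_q=\frac{(q;q)_n}{(q;q)_k(q;q)_{n-k}}$, the generalized Cauchy polynomials are $$p_n(x,y,a)=\sum_{k=0}^n\binom{n}{k}_q(-1)^kq^{k(k-1)/2}(a;q)_k\,x^{n-k}y^k.$$ The identities and convergence are understood for $x,y$ in a neighborhood of the origin. *)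

theory Defs
  imports "HOL-Analysis.Analysis"
begin

definition qpoch :: "complex \<Rightarrow> complex \<Rightarrow> nat \<Rightarrow> complex" where
  "qpoch a q n = (\<Prod>i<n. 1 - a * q ^ i)"

text \<open>For \<open>norm q < 1\<close> the product below converges in the sense of \<^const>\<open>convergent_prod\<close>
  for every \<open>a\<close>; it is \<open>0\<close> exactly when some factor vanishes.\<close>

definition qpoch_inf :: "complex \<Rightarrow> complex \<Rightarrow> complex" where
  "qpoch_inf a q = (\<Prod>i. 1 - a * q ^ i)"

definition qbinom :: "complex \<Rightarrow> nat \<Rightarrow> nat \<Rightarrow> complex" where
  "qbinom q n k = qpoch q q n / (qpoch q q k * qpoch q q (n - k))"

text \<open>The series \<open>\<^sub>1\<Phi>\<^sub>1\<close> with upper parameter \<open>a\<close> and lower parameter \<open>0\<close>. For \<open>norm q < 1\<close>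
  the denominators are nonzero and the series converges for every \<open>z\<close>.\<close>

definition Phi11 :: "complex \<Rightarrow> complex \<Rightarrow> complex \<Rightarrow> complex" where
  "Phi11 a q z =
     (\<Sum>n. (- 1) ^ n * q ^ (n * (n - 1) div 2) * (qpoch a q n / qpoch q q n) * z ^ n)"

definition gen_cauchy_poly ::
    "complex \<Rightarrow> nat \<Rightarrow> complex \<Rightarrow> complex \<Rightarrow> complex \<Rightarrow> complex" where
  "gen_cauchy_poly q n x y a =
     (\<Sum>k\<le>n. qbinom q n k * (- 1) ^ k * q ^ (k * (k - 1) div 2) * qpoch a q k
              * x ^ (n - k) * y ^ k)"

end

theory Submission
  imports Defs
begin

text \<open>
  Write \<open>b\<^sub>n\<close> for the sum of \<open>B k * q ^ (k * n)\<close> over \<open>k\<close>. For a power series with coefficients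
  \<open>u n\<close>, summing \<open>B k\<close> times its value at \<open>q ^ k\<close> over \<open>k\<close> gives the sum of \<open>u n * b\<^sub>n\<close>, provided
  the two summations may be interchanged. The theorem is this identity for two choices of \<open>u\<close>.

  \<^item> By Euler, \<open>1 / (z;q)\<^sub>\<infinity>\<close> is the sum of \<open>z ^ n / (q;q)\<^sub>n\<close> (\<open>euler_series\<close>). With
    \<open>u n = (x * t) ^ n / (q;q)\<^sub>n\<close> the interchange turns the right-hand side of the given identity
    into a power series in \<open>x\<close>, and comparing coefficients yields
    \<open>A n = t ^ n * b\<^sub>n / (q;q)\<^sub>n\<close> (\<open>coefficients_from_euler_expansion\<close>).

  \<^item> The Cauchy product of Euler's series at \<open>x\<close> with the series \<open>\<^sub>1\<Phi>\<^sub>1\<close> at \<open>y\<close> has the coefficients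
    \<open>p\<^sub>n(x,y,a) / (q;q)\<^sub>n\<close> (\<open>gen_cauchy_poly_generating_function\<close>), and \<open>p\<^sub>n\<close> is homogeneous of
    degree \<open>n\<close> in \<open>(x,y)\<close>. With \<open>u n = p\<^sub>n(x * t, y * t, a) / (q;q)\<^sub>n\<close> the same interchange gives
    the claim, because \<open>u n * b\<^sub>n = A n * p\<^sub>n(x,y,a)\<close> (\<open>gen_cauchy_poly_augmentation\<close>).

  About \<open>B\<close> it is only known that its series converges, perhaps conditionally: this is the
  convergence assumption read at \<open>x = 0\<close>. The double series therefore need not converge
  absolutely, and the interchange rests on Tannery's theorem applied to the partial sums over
  \<open>k\<close>, which are bounded uniformly in \<open>n\<close> (\<open>sums_interchange_geometric_weights\<close>).
\<close>

section \<open>Interchanging a conditionally convergent sum with a power series\<close>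

text \<open>For \<open>n = 0\<close> the sums are the partial sums of a convergent series; for \<open>n \<ge> 1\<close> the weights
  are at most \<open>norm q ^ k\<close> in norm, and boundedness of \<open>B\<close> gives a geometric majorant that does not
  depend on \<open>n\<close>. The uniformity in both \<open>n\<close> and \<open>N\<close> is what dominated convergence needs below.\<close>

lemma geometric_weights_sum_bound:
  fixes B :: "nat \<Rightarrow> complex" and q :: complex
  assumes q: "norm q < 1" and B: "summable B"
  shows "\<exists>C. \<forall>n N. norm (\<Sum>k<N. B k * (q ^ k) ^ n) \<le> C"
proof -
  have "Bseq (\<lambda>N. \<Sum>k<N. B k)"
    using B by (intro convergent_imp_Bseq) (simp add: summable_iff_convergent)
  then obtain K where K: "K > 0" "\<And>N. norm (\<Sum>k<N. B k) \<le> K"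
    by (auto simp: Bseq_def)
  have "Bseq B"
    using summable_LIMSEQ_zero[OF B] by (intro convergent_imp_Bseq convergentI)
  then obtain M where M: "M > 0" "\<And>k. norm (B k) \<le> M"
    by (auto simp: Bseq_def)
  have geo: "summable (\<lambda>k. M * norm q ^ k)"
    using q by (intro summable_mult summable_geometric) auto
  have geo_nonneg: "0 \<le> (\<Sum>k. M * norm q ^ k)"
    using geo M(1) by (intro suminf_nonneg) auto
  have "norm (\<Sum>k<N. B k * (q ^ k) ^ n) \<le> K + (\<Sum>k. M * norm q ^ k)" for n N
  proof (cases n)
    case 0
    then show ?thesis
      using K(2)[of N] geo_nonneg by simp
  next
    case (Suc m)
    have "norm (B k * (q ^ k) ^ n) \<le> M * norm q ^ k" for k
    proof -
      have "norm q ^ (k * n) \<le> norm q ^ k"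
        using q Suc by (intro power_decreasing) auto
      then show ?thesis
        using M(2)[of k] M(1)
        by (simp add: norm_mult norm_power flip: power_mult) (intro mult_mono; simp)
    qed
    then have "norm (\<Sum>k<N. B k * (q ^ k) ^ n) \<le> (\<Sum>k<N. M * norm q ^ k)"
      by (rule sum_norm_le)
    also have "\<dots> \<le> (\<Sum>k. M * norm q ^ k)"
      using geo M(1) by (intro sum_le_suminf) auto
    finally show ?thesis
      using K(1) by linarith
  qed
  then show ?thesis
    by blast
qed

lemma summable_geometric_weights:
  fixes B :: "nat \<Rightarrow> complex" and q :: complex
  assumes q: "norm q < 1" and B: "summable B"
  shows "summable (\<lambda>k. B k * (q ^ k) ^ n)"
proof (cases n)
  case 0
  then show ?thesis
    using B by simp
next
  case (Suc m)
  have "Bseq B"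
    using summable_LIMSEQ_zero[OF B] by (intro convergent_imp_Bseq convergentI)
  then obtain M where M: "\<And>k. norm (B k) \<le> M"
    by (auto simp: Bseq_def)
  have "norm (q ^ n) < 1"
    using q Suc by (simp add: norm_power power_less_one_iff del: power_Suc)
  then have geo: "summable (\<lambda>k. M * norm (q ^ n) ^ k)"
    by (intro summable_mult summable_geometric) simp
  have weight: "norm ((q ^ k) ^ n) = norm (q ^ n) ^ k" for k
    by (metis mult.commute norm_power power_mult)
  have "norm (B k * (q ^ k) ^ n) \<le> M * norm (q ^ n) ^ k" for k
    unfolding norm_mult[of "B k"] weight by (intro mult_right_mono M) simp
  then show ?thesis
    by (rule summable_comparison_test'[OF geo, where N = 0])
qed

text \<open>Truncating the sum over \<open>k\<close> at \<open>N\<close> makes the interchange a finite one. The limit in \<open>N\<close> may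
  then be taken under the sum over \<open>n\<close> by Tannery's theorem, with the majorant \<open>C * norm (u n)\<close>.\<close>

lemma sums_interchange_geometric_weights:
  fixes B u :: "nat \<Rightarrow> complex" and q :: complex
  assumes q: "norm q < 1" and B: "summable B" and u: "summable (\<lambda>n. norm (u n))"
  shows "summable (\<lambda>n. u n * (\<Sum>k. B k * (q ^ k) ^ n))"
    and "(\<lambda>k. B k * (\<Sum>n. u n * (q ^ k) ^ n)) sums (\<Sum>n. u n * (\<Sum>k. B k * (q ^ k) ^ n))"
proof -
  obtain C where C: "\<And>n N. norm (\<Sum>k<N. B k * (q ^ k) ^ n) \<le> C"
    using geometric_weights_sum_bound[OF q B] by blast
  have limit: "(\<lambda>N. u n * (\<Sum>k<N. B k * (q ^ k) ^ n)) \<longlonglongrightarrow> u n * (\<Sum>k. B k * (q ^ k) ^ n)" for n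
    using summable_geometric_weights[OF q B]
    by (intro tendsto_mult tendsto_const summable_LIMSEQ)
  have bound: "norm (u n * (\<Sum>k<N. B k * (q ^ k) ^ n)) \<le> norm (u n) * C" for n N
    using C by (simp add: norm_mult mult_left_mono)
  have tannery: "summable (\<lambda>n. norm (u n * (\<Sum>k. B k * (q ^ k) ^ n)))"
    "(\<lambda>N. \<Sum>n. u n * (\<Sum>k<N. B k * (q ^ k) ^ n)) \<longlonglongrightarrow> (\<Sum>n. u n * (\<Sum>k. B k * (q ^ k) ^ n))"
    using tannerys_theorem[of "\<lambda>n N. u n * (\<Sum>k<N. B k * (q ^ k) ^ n)", OF limit,
        of "\<lambda>n. norm (u n) * C"] bound summable_mult2[OF u, of C]
    by (simp_all add: case_prod_unfold)
  show "summable (\<lambda>n. u n * (\<Sum>k. B k * (q ^ k) ^ n))"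
    using tannery(1) by (rule summable_norm_cancel)
  have "(\<Sum>n. u n * (\<Sum>k<N. B k * (q ^ k) ^ n)) = (\<Sum>k<N. B k * (\<Sum>n. u n * (q ^ k) ^ n))" for N
  proof -
    have uk: "summable (\<lambda>n. u n * (q ^ k) ^ n)" for k
    proof (rule summable_comparison_test'[OF u])
      have "norm ((q ^ k) ^ n) \<le> 1" for n
        using q by (simp add: norm_power power_le_one)
      then show "norm (u n * (q ^ k) ^ n) \<le> norm (u n)" for n
        unfolding norm_mult by (rule mult_right_le_one_le[rotated 2]) auto
    qed
    have "(\<Sum>n. u n * (\<Sum>k<N. B k * (q ^ k) ^ n)) = (\<Sum>n. \<Sum>k<N. B k * (u n * (q ^ k) ^ n))"
      by (simp add: sum_distrib_left mult_ac)
    also have "\<dots> = (\<Sum>k<N. \<Sum>n. B k * (u n * (q ^ k) ^ n))"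
      by (intro suminf_sum summable_mult uk)
    also have "\<dots> = (\<Sum>k<N. B k * (\<Sum>n. u n * (q ^ k) ^ n))"
      by (simp add: suminf_mult uk)
    finally show ?thesis .
  qed
  then show "(\<lambda>k. B k * (\<Sum>n. u n * (q ^ k) ^ n)) sums (\<Sum>n. u n * (\<Sum>k. B k * (q ^ k) ^ n))"
    using tannery(2) by (simp add: sums_def)
qed

section \<open>Euler's expansion of the reciprocal infinite product\<close>

lemma qpoch_0 [simp]: "qpoch a q 0 = 1"
  by (simp add: qpoch_def)

lemma qpoch_Suc: "qpoch a q (Suc n) = qpoch a q n * (1 - a * q ^ n)"
  by (simp add: qpoch_def)

lemma norm_mult_power_less_1:
  fixes z q :: complex
  assumes "norm z < 1" "norm q \<le> 1"
  shows "norm (z * q ^ n) < 1"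
proof -
  have "norm q ^ n \<le> 1"
    using assms(2) by (simp add: power_le_one)
  then have "norm (z * q ^ n) \<le> norm z"
    by (simp add: norm_mult norm_power mult_right_le_one_le)
  with assms(1) show ?thesis
    by linarith
qed

lemma one_minus_power_nonzero:
  fixes z q :: complex
  assumes "norm z < 1" "norm q \<le> 1"
  shows "1 - z * q ^ n \<noteq> 0"
  using norm_mult_power_less_1[OF assms, of n] by auto

lemma qpoch_self_nonzero: "norm q < 1 \<Longrightarrow> qpoch q q n \<noteq> 0"
  unfolding qpoch_def using one_minus_power_nonzero[of q q] by auto

lemma convergent_prod_qpoch:
  fixes a q :: complex
  assumes "norm q < 1"
  shows "convergent_prod (\<lambda>i. 1 - a * q ^ i)"
proof (intro abs_convergent_prod_imp_convergent_prod summable_imp_abs_convergent_prod)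
  show "summable (\<lambda>i. norm (1 - a * q ^ i - 1))"
    using assms by (auto simp: norm_mult norm_power intro!: summable_mult summable_geometric)
qed

lemma qpoch_tendsto_qpoch_inf:
  assumes "norm q < 1"
  shows "qpoch a q \<longlonglongrightarrow> qpoch_inf a q"
proof -
  have "(\<lambda>n. qpoch a q (Suc n)) \<longlonglongrightarrow> qpoch_inf a q"
    unfolding qpoch_def qpoch_inf_def
    using convergent_prod_LIMSEQ[OF convergent_prod_qpoch[OF assms]]
    by (simp add: lessThan_Suc_atMost)
  then show ?thesis
    by (rule LIMSEQ_imp_Suc)
qed

lemma qpoch_inf_nonzero:
  assumes "norm q < 1" "norm z < 1"
  shows "qpoch_inf z q \<noteq> 0"
  unfolding qpoch_inf_def
  using assms by (intro prodinf_nonzero convergent_prod_qpoch one_minus_power_nonzero) auto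

lemma qpoch_inf_0 [simp]: "qpoch_inf 0 q = 1"
  by (simp add: qpoch_inf_def)

text \<open>Numerator and denominator converge, the denominator to a nonzero limit, so the quotients
  are bounded and the series is dominated by a geometric one.\<close>

lemma summable_norm_qpoch_ratio:
  assumes "norm q < 1" "norm z < 1"
  shows "summable (\<lambda>n. norm (qpoch a q n / qpoch q q n * z ^ n))"
proof -
  have "(\<lambda>n. qpoch a q n / qpoch q q n) \<longlonglongrightarrow> qpoch_inf a q / qpoch_inf q q"
    using assms(1) by (intro tendsto_divide qpoch_tendsto_qpoch_inf qpoch_inf_nonzero)
  then have "Bseq (\<lambda>n. qpoch a q n / qpoch q q n)"
    by (intro convergent_imp_Bseq convergentI)
  then obtain M where M: "\<And>n. norm (qpoch a q n / qpoch q q n) \<le> M"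
    by (auto simp: Bseq_def)
  have "summable (\<lambda>n. M * norm z ^ n)"
    using assms(2) by (intro summable_mult summable_geometric) auto
  then show ?thesis
  proof (rule summable_comparison_test'[where N = 0])
    have "norm (qpoch a q n / qpoch q q n * z ^ n) \<le> M * norm z ^ n" for n
      unfolding norm_mult norm_power by (intro mult_right_mono M) simp
    then show "norm (norm (qpoch a q n / qpoch q q n * z ^ n)) \<le> M * norm z ^ n" for n
      unfolding real_norm_def abs_norm_cancel .
  qed
qed

lemma summable_norm_euler:
  assumes "norm q < 1" "norm z < 1"
  shows "summable (\<lambda>n. norm (z ^ n / qpoch q q n))"
  using summable_norm_qpoch_ratio[OF assms, of 0] by (simp add: qpoch_def)

text \<open>The functional equation behind Euler's expansion: in \<open>F z - F (z * q)\<close> the factor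
  \<open>1 - q ^ (n + 1)\<close> cancels the last factor of \<open>(q;q)\<^sub>n\<^sub>+\<^sub>1\<close>, and what is left is \<open>z * F z\<close>.\<close>

lemma euler_series_shift:
  fixes q z :: complex
  assumes q: "norm q < 1" and z: "norm z < 1"
  defines "F \<equiv> \<lambda>z. \<Sum>n. z ^ n / qpoch q q n"
  shows "(1 - z) * F z = F (z * q)"
proof -
  have zq: "norm (z * q) < 1"
    using q z by (simp add: norm_mult) (metis mult_strict_mono' norm_ge_zero mult_1)
  note s = summable_norm_cancel[OF summable_norm_euler[OF q z]]
    and sq = summable_norm_cancel[OF summable_norm_euler[OF q zq]]
  have coeff: "z ^ Suc n / qpoch q q (Suc n) - (z * q) ^ Suc n / qpoch q q (Suc n)
      = z * (z ^ n / qpoch q q n)" for n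
  proof -
    have "1 - q * q ^ n \<noteq> 0"
      using q by (intro one_minus_power_nonzero) auto
    moreover have "z ^ Suc n / qpoch q q (Suc n) - (z * q) ^ Suc n / qpoch q q (Suc n)
        = z * z ^ n * (1 - q * q ^ n) / (qpoch q q n * (1 - q * q ^ n))"
      by (simp add: qpoch_Suc power_mult_distrib right_diff_distrib mult_ac
               flip: diff_divide_distrib)
    ultimately show ?thesis
      by simp
  qed
  have "F z - F (z * q) = (\<Sum>n. z ^ n / qpoch q q n - (z * q) ^ n / qpoch q q n)"
    unfolding F_def by (rule suminf_diff[OF s sq])
  also have "\<dots> = (\<Sum>n. z ^ Suc n / qpoch q q (Suc n) - (z * q) ^ Suc n / qpoch q q (Suc n))"
    using suminf_split_head[OF summable_diff[OF s sq]] by simp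
  also have "\<dots> = z * F z"
    unfolding coeff F_def by (rule suminf_mult[OF s])
  finally show ?thesis
    by (simp add: algebra_simps)
qed

text \<open>Iterating the functional equation gives \<open>(z;q)\<^sub>N * F z = F (z * q ^ N)\<close>. As \<open>N\<close> grows, the
  right-hand side tends to \<open>F 0 = 1\<close> by continuity of the power series at the origin.\<close>

theorem euler_series:
  fixes q z :: complex
  assumes q: "norm q < 1" and z: "norm z < 1"
  shows "(\<Sum>n. z ^ n / qpoch q q n) = 1 / qpoch_inf z q"
proof -
  define F where "F = (\<lambda>z. \<Sum>n. z ^ n / qpoch q q n)"
  have small: "norm (z * q ^ N) < 1" for N
    using q z by (intro norm_mult_power_less_1) auto
  have shift: "qpoch z q N * F z = F (z * q ^ N)" for N
  proof (induction N)
    case (Suc N)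
    have "qpoch z q (Suc N) * F z = (1 - z * q ^ N) * F (z * q ^ N)"
      by (simp add: qpoch_Suc flip: Suc)
    also have "\<dots> = F (z * q ^ Suc N)"
      using euler_series_shift[OF q small, of N] by (simp add: F_def mult_ac)
    finally show ?case .
  qed simp
  have "isCont F 0"
  proof -
    have "summable (\<lambda>n. inverse (qpoch q q n) * (1 / 2) ^ n)"
      using summable_norm_cancel[OF summable_norm_euler[OF q, of "1/2"]]
      by (simp add: field_simps)
    then have "isCont (\<lambda>z. \<Sum>n. inverse (qpoch q q n) * z ^ n) 0"
      by (rule isCont_powser) simp
    then show ?thesis
      by (simp add: F_def field_simps)
  qed
  moreover have "(\<lambda>N. z * q ^ N) \<longlonglongrightarrow> 0"
    using tendsto_mult_right_zero[OF LIMSEQ_power_zero[OF q]] by simp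
  ultimately have "(\<lambda>N. F (z * q ^ N)) \<longlonglongrightarrow> F 0"
    by (rule isCont_tendsto_compose)
  moreover have "F 0 = 1"
    using powser_sums_zero[of "\<lambda>n. inverse (qpoch q q n)"]
    by (simp add: F_def sums_iff field_simps)
  moreover have "(\<lambda>N. qpoch z q N * F z) \<longlonglongrightarrow> qpoch_inf z q * F z"
    by (intro tendsto_mult tendsto_const qpoch_tendsto_qpoch_inf q)
  ultimately have "qpoch_inf z q * F z = 1"
    using LIMSEQ_unique by (simp add: shift)
  then show ?thesis
    using qpoch_inf_nonzero[OF q z] by (simp add: F_def field_simps)
qed

section \<open>The generating function of the generalized Cauchy polynomials\<close>

text \<open>Homogeneity is what lets the powers \<open>(q ^ k) ^ n\<close> move into the arguments of the polynomial.\<close>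

lemma gen_cauchy_poly_scale:
  "gen_cauchy_poly q n (x * z) (y * z) a = z ^ n * gen_cauchy_poly q n x y a"
proof -
  have "(x * z) ^ (n - k) * (y * z) ^ k = z ^ n * (x ^ (n - k) * y ^ k)" if "k \<le> n" for k
  proof -
    have "z ^ n = z ^ (n - k) * z ^ k"
      using that by (simp flip: power_add)
    then show ?thesis
      by (simp add: power_mult_distrib mult_ac)
  qed
  then show ?thesis
    unfolding gen_cauchy_poly_def sum_distrib_left
    by (intro sum.cong) (auto simp: mult_ac)
qed

text \<open>Dividing by \<open>(q;q)\<^sub>n\<close> splits the \<open>q\<close>-binomial coefficient into one factor for each of the two
  series, which exhibits the quotient as a coefficient of their Cauchy product.\<close>

lemma gen_cauchy_poly_convolution:
  assumes "norm q < 1"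
  shows "gen_cauchy_poly q n x y a / qpoch q q n =
    (\<Sum>i\<le>n. (- 1) ^ i * q ^ (i * (i - 1) div 2) * (qpoch a q i / qpoch q q i) * y ^ i
      * (x ^ (n - i) / qpoch q q (n - i)))"
  unfolding gen_cauchy_poly_def sum_divide_distrib qbinom_def
  using qpoch_self_nonzero[OF assms] by (intro sum.cong) (auto simp: field_simps)

lemma summable_norm_Phi11:
  assumes "norm q < 1" "norm z < 1"
  shows "summable (\<lambda>n. norm
    ((- 1) ^ n * q ^ (n * (n - 1) div 2) * (qpoch a q n / qpoch q q n) * z ^ n))"
proof (rule summable_comparison_test'[OF summable_norm_qpoch_ratio[OF assms]])
  fix n :: nat
  have "norm q ^ (n * (n - 1) div 2) \<le> 1"
    using assms(1) by (intro power_le_one) auto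
  then have "norm q ^ (n * (n - 1) div 2) * norm (qpoch a q n / qpoch q q n * z ^ n)
      \<le> norm (qpoch a q n / qpoch q q n * z ^ n)"
    by (rule mult_left_le_one_le[rotated 2]) auto
  then show "norm (norm
      ((- 1) ^ n * q ^ (n * (n - 1) div 2) * (qpoch a q n / qpoch q q n) * z ^ n))
      \<le> norm (qpoch a q n / qpoch q q n * z ^ n)"
    by (simp add: norm_mult norm_power norm_divide mult_ac)
qed

text \<open>Both factors of the Cauchy product converge absolutely. The absolute convergence of the product
  series comes from the Cauchy product of the norms.\<close>

theorem gen_cauchy_poly_generating_function:
  assumes q: "norm q < 1" and x: "norm x < 1" and y: "norm y < 1"
  shows "summable (\<lambda>n. norm (gen_cauchy_poly q n x y a / qpoch q q n))"
    and "(\<Sum>n. gen_cauchy_poly q n x y a / qpoch q q n) = 1 / qpoch_inf x q * Phi11 a q y"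
proof -
  note c = summable_norm_Phi11[OF q y, of a] and d = summable_norm_euler[OF q x]
  show "(\<Sum>n. gen_cauchy_poly q n x y a / qpoch q q n) = 1 / qpoch_inf x q * Phi11 a q y"
    using sums_unique[OF Cauchy_product_sums[OF c d]]
    by (simp add: gen_cauchy_poly_convolution[OF q] euler_series[OF q x] Phi11_def)
  have "summable (\<lambda>n. \<Sum>i\<le>n.
      norm ((- 1) ^ i * q ^ (i * (i - 1) div 2) * (qpoch a q i / qpoch q q i) * y ^ i)
      * norm (x ^ (n - i) / qpoch q q (n - i)))"
    using c d by (intro summable_Cauchy_product) auto
  then show "summable (\<lambda>n. norm (gen_cauchy_poly q n x y a / qpoch q q n))"
    unfolding gen_cauchy_poly_convolution[OF q]
    by (rule summable_comparison_test') (auto intro!: sum_norm_le simp: norm_mult norm_divide norm_power)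
qed

section \<open>Parameter augmentation\<close>

lemma eventually_norm_mult_less_1:
  fixes t :: complex
  shows "\<forall>\<^sub>F x in nhds 0. norm (x * t) < 1"
proof -
  have "((\<lambda>x. norm (x * t)) \<longlongrightarrow> norm (0 * t)) (nhds 0)"
    by (intro tendsto_intros filterlim_ident)
  then show ?thesis
    by (rule order_tendstoD) simp
qed

lemma power_series_coeffs_unique:
  fixes A C :: "nat \<Rightarrow> complex"
  assumes A: "\<forall>\<^sub>F x in nhds 0. summable (\<lambda>k. A k * x ^ k)"
    and C: "\<forall>\<^sub>F x in nhds 0. summable (\<lambda>k. C k * x ^ k)"
    and eq: "\<forall>\<^sub>F x in nhds 0. (\<Sum>k. A k * x ^ k) = (\<Sum>k. C k * x ^ k)"
  shows "A = C"
proof -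
  have radius: "fps_conv_radius (Abs_fps D) > 0"
    if "\<forall>\<^sub>F x in nhds 0. summable (\<lambda>k. D k * x ^ k)" for D :: "nat \<Rightarrow> complex"
  proof -
    from that have "\<forall>\<^sub>F x in at 0. summable (\<lambda>k. D k * x ^ k)"
      by (simp add: eventually_nhds_conv_at)
    moreover have "\<forall>\<^sub>F x :: complex in at 0. x \<noteq> 0"
      by (simp add: eventually_at_filter)
    ultimately have "\<forall>\<^sub>F x in at 0. summable (\<lambda>k. D k * x ^ k) \<and> x \<noteq> 0"
      by (rule eventually_conj)
    then obtain x where x: "summable (\<lambda>k. D k * x ^ k)" "x \<noteq> 0"
      using eventually_happens[of _ "at (0 :: complex)"] by auto
    have "ereal 0 < ereal (norm x)"
      using x(2) by simp
    also have "\<dots> \<le> conv_radius D"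
      using x(1) by (rule conv_radius_geI)
    finally show ?thesis
      by (simp add: fps_conv_radius_def zero_ereal_def)
  qed
  have "Abs_fps A = Abs_fps C"
    using eq by (intro eval_fps_eqD radius A C) (simp add: eval_fps_def)
  then show ?thesis
    by (simp add: fps_eq_iff fun_eq_iff)
qed

text \<open>Interchanging summations in the Euler expansion produces a second power series that
  represents the same function near the origin, so its coefficients are those of \<open>A\<close>.\<close>

lemma coefficients_from_euler_expansion:
  fixes q t :: complex and A B :: "nat \<Rightarrow> complex"
  assumes q: "norm q < 1" and B: "summable B"
    and A: "\<forall>\<^sub>F x in nhds 0. summable (\<lambda>k. A k * x ^ k)"
    and AB: "\<forall>\<^sub>F x in nhds 0.
           (\<Sum>k. A k * x ^ k) = (\<Sum>k. B k * (1 / qpoch_inf (x * t * q ^ k) q))"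
  shows "A n = t ^ n / qpoch q q n * (\<Sum>k. B k * (q ^ k) ^ n)"
proof -
  define C where "C = (\<lambda>n. t ^ n / qpoch q q n * (\<Sum>k. B k * (q ^ k) ^ n))"
  have C: "summable (\<lambda>n. C n * x ^ n) \<and>
      (\<Sum>k. B k * (1 / qpoch_inf (x * t * q ^ k) q)) = (\<Sum>n. C n * x ^ n)"
    if x: "norm (x * t) < 1" for x
  proof -
    have factor: "C n * x ^ n = (x * t) ^ n / qpoch q q n * (\<Sum>k. B k * (q ^ k) ^ n)" for n
      by (simp add: C_def power_mult_distrib mult_ac)
    have euler: "(\<Sum>n. (x * t) ^ n / qpoch q q n * (q ^ k) ^ n) = 1 / qpoch_inf (x * t * q ^ k) q"
      for k
      using euler_series[OF q norm_mult_power_less_1[OF x], of q k] q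
      by (simp add: power_mult_distrib)
    show ?thesis
      using sums_interchange_geometric_weights[OF q B summable_norm_euler[OF q x]]
      unfolding factor euler sums_iff by blast
  qed
  have near: "\<forall>\<^sub>F x in nhds 0. norm (x * t) < 1"
    by (rule eventually_norm_mult_less_1)
  have "\<forall>\<^sub>F x in nhds 0. (\<Sum>k. A k * x ^ k) = (\<Sum>k. C k * x ^ k)"
    using AB near by eventually_elim (use C in simp)
  moreover have "\<forall>\<^sub>F x in nhds 0. summable (\<lambda>k. C k * x ^ k)"
    using near by eventually_elim (use C in simp)
  ultimately have "A = C"
    by (intro power_series_coeffs_unique A)
  then show ?thesis
    by (simp add: C_def)
qed

text \<open>The summand on the right is \<open>A n * p\<^sub>n(x,y,a)\<close> with \<open>A\<close> replaced by the closed form just found;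
  the equality is the interchange lemma applied to the generating function of the polynomials.\<close>

lemma gen_cauchy_poly_augmentation:
  fixes q t :: complex and B :: "nat \<Rightarrow> complex"
  assumes q: "norm q < 1" and B: "summable B"
    and x: "norm (x * t) < 1" and y: "norm (y * t) < 1"
  shows "(\<lambda>k. B k * (1 / qpoch_inf (x * t * q ^ k) q) * Phi11 a q (y * t * q ^ k)) sums
    (\<Sum>n. t ^ n / qpoch q q n * (\<Sum>k. B k * (q ^ k) ^ n) * gen_cauchy_poly q n x y a)"
proof -
  define u where "u = (\<lambda>n. gen_cauchy_poly q n (x * t) (y * t) a / qpoch q q n)"
  have u_eq: "t ^ n / qpoch q q n * (\<Sum>k. B k * (q ^ k) ^ n) * gen_cauchy_poly q n x y a
      = u n * (\<Sum>k. B k * (q ^ k) ^ n)" for n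
    unfolding u_def gen_cauchy_poly_scale[of q n x t y a] by simp
  have "(\<Sum>n. u n * (q ^ k) ^ n)
      = 1 / qpoch_inf (x * t * q ^ k) q * Phi11 a q (y * t * q ^ k)" for k
  proof -
    have "u n * (q ^ k) ^ n = gen_cauchy_poly q n (x * t * q ^ k) (y * t * q ^ k) a / qpoch q q n"
      for n
      unfolding u_def gen_cauchy_poly_scale[of q n "x * t" "q ^ k" "y * t" a] by simp
    moreover have "norm (x * t * q ^ k) < 1" "norm (y * t * q ^ k) < 1"
      using q x y by (auto intro!: norm_mult_power_less_1)
    ultimately show ?thesis
      by (simp only: gen_cauchy_poly_generating_function(2)[OF q])
  qed
  note generating = this
  have "summable (\<lambda>n. norm (u n))"
    unfolding u_def by (rule gen_cauchy_poly_generating_function(1)[OF q x y])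
  from sums_interchange_geometric_weights(2)[OF q B this]
  have S: "(\<lambda>k. B k * (1 / qpoch_inf (x * t * q ^ k) q * Phi11 a q (y * t * q ^ k))) sums
      (\<Sum>n. u n * (\<Sum>k. B k * (q ^ k) ^ n))"
    unfolding generating .
  show ?thesis
    unfolding u_eq mult.assoc[of "B _"] by (rule S)
qed

text \<open>For \<open>(x, y)\<close> near the origin both \<open>x * t\<close> and \<open>y * t\<close> lie in the open unit disc, where the
  expansions above are valid.\<close>

theorem theorem5p1:
  fixes q a t :: complex and A B :: "nat \<Rightarrow> complex"
  assumes "norm q < 1"
    and "\<forall>\<^sub>F x in nhds 0. summable (\<lambda>k. A k * x ^ k)"
    and "\<forall>\<^sub>F x in nhds 0. summable (\<lambda>k. B k * (1 / qpoch_inf (x * t * q ^ k) q))"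
    and "\<forall>\<^sub>F x in nhds 0.
           (\<Sum>k. A k * x ^ k) = (\<Sum>k. B k * (1 / qpoch_inf (x * t * q ^ k) q))"
    and "\<forall>\<^sub>F (x, y) in nhds (0, 0). summable (\<lambda>k. A k * gen_cauchy_poly q k x y a)"
    and "\<forall>\<^sub>F (x, y) in nhds (0, 0).
           summable (\<lambda>k. B k * (1 / qpoch_inf (x * t * q ^ k) q) * Phi11 a q (y * t * q ^ k))"
  shows "\<forall>\<^sub>F (x, y) in nhds (0, 0).
           (\<Sum>k. A k * gen_cauchy_poly q k x y a) =
           (\<Sum>k. B k * (1 / qpoch_inf (x * t * q ^ k) q) * Phi11 a q (y * t * q ^ k))"
proof -
  \<comment> \<open>At \<open>x = 0\<close> every infinite product equals \<open>1\<close>.\<close>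
  have B: "summable B"
    using eventually_nhds_x_imp_x[OF assms(3)] by simp
  have "A n = t ^ n / qpoch q q n * (\<Sum>k. B k * (q ^ k) ^ n)" for n
    using assms(1,2,4) B by (intro coefficients_from_euler_expansion)
  moreover have "\<forall>\<^sub>F (x, y) in nhds (0, 0). norm (x * t) < 1 \<and> norm (y * t) < 1"
    unfolding nhds_prod case_prod_beta
    using eventually_norm_mult_less_1[of t]
    by (auto simp: eventually_prod_filter)
  ultimately show ?thesis
    using gen_cauchy_poly_augmentation[OF assms(1) B]
    by (auto elim!: eventually_mono simp: sums_iff)
qed

end
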